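(* Let $\varepsilon:\mathcal{K}_2\to 2^\omega$ be the applicative morphism given by the function $\varepsilon(\alpha)([n,m])=1$ if $\alpha(n)=m$ and $\varepsilon(\alpha)([n,m])=0$ otherwise, and let $\zeta:2^\omega\to\mathcal{K}_2$ be the applicative morphism given by the inclusion of $\{0,1\}^{\mathbb{N}}$ in $\mathbb{N}^{\mathbb{N}}$. Then $\varepsilon$ and $\zeta$ give an equivalence between the pcas $2^\omega$ and $\mathcal{K}_2$; that is, $\zeta\circ\varepsilon\simeq\mathrm{id}_{\mathcal{K}_2}$ and $\varepsilon\circ\zeta\simeq\mathrm{id}_{2^\omega}$.
   Context: A partial combinatory algebra (pca) is a set $\mathcal{A}$ with a partial binary application $(a,b)\mapsto ab$ (associating to the left) such that there are $\mathsf{k},\mathsf{s}\in\mathcal{A}$ with, for all $a,b,c$: $\mathsf{k}ab=a$; $\mathsf{s}ab$ is defined; and whenever $(ac)(bc)$ is defined, $\mathsf{s}abc$ is defined and equals $(ac)(bc)$. An applicative morphism $\gamma:\mathcal{A}\to\mathcal{B}$ of pcas assigns to every $a\in\mathcal{A}$ a nonempty subset $\gamma(a)\subseteq\mathcal{B}$ such that there is $r\in\mathcal{B}$ with: whenever $aa'$ is defined in $\mathcal{A}$, $b\in\gamma(a)$, $b'\in\gamma(a')$, then $rbb'$ is defined and lies in $\gamma(aa')$. A function is regarded as a single-valued relation. Composition is composition of relations. For $\gamma,\delta:\mathcal{A}\to\mathcal{B}$, $\gamma\leq\delta$ means there is $s\in\mathcal{B}$ such that for all $a\in\mathcal{A}$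 and $b\in\gamma(a)$, $sb$ is defined and $sb\in\delta(a)$; $\gamma\simeq\delta$ means $\gamma\leq\delta$ and $\delta\leq\gamma$. Below $[\cdot,\cdot]$ is a standard bijective pairing on $\mathbb{N}$ and $[\cdot,\ldots,\cdot]$ a standard coding of finite sequences of natural numbers by natural numbers. $\mathcal{K}_2$ (Kleene's second model): underlying set $\mathbb{N}^{\mathbb{N}}$; $\alpha\beta$ is defined iff for every $n$ there is $k$ with $\alpha([n,\beta(0),\ldots,\beta(k-1)])>0$, and then $(\alpha\beta)(n)=\alpha([n,\beta(0),\ldots,\beta(k-1)])-1$ for the least such $k$. $2^\omega$: underlying set $\{0,1\}^{\mathbb{N}}$; $\alpha\cdot\beta$ is defined iff for every $n$ there is $k$ with $\alpha([n,\beta(0),\ldots,\beta(k-1)])=1$, and then $(\alpha\cdot\beta)(n)=\alpha([n,\beta(0),\ldots,\beta(k)])$ for the least such $k$. *)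

theory Defs
  imports Main "HOL-Library.Nat_Bijection"
begin

record 'a part_app =
  carrier :: "'a set"
  app :: "'a \<Rightarrow> 'a \<Rightarrow> 'a option"

text \<open>Application of possibly undefined terms: strict in both arguments, so that
  \<open>Some a \<bullet>\<^bsub>A\<^esub> Some b \<bullet>\<^bsub>A\<^esub> Some c = Some d\<close>
  says that the term \<open>a b c\<close> is defined with value \<open>d\<close>.\<close>

definition papp :: "('a, 'm) part_app_scheme \<Rightarrow> 'a option \<Rightarrow> 'a option \<Rightarrow> 'a option"
    (infixl "\<bullet>\<index>" 70) where
  "x \<bullet>\<^bsub>A\<^esub> y = Option.bind x (\<lambda>a. Option.bind y (\<lambda>b. app A a b))"

definition pca :: "('a, 'm) part_app_scheme \<Rightarrow> bool" where
  "pca A \<longleftrightarrow>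
     (\<forall>a\<in>carrier A. \<forall>b\<in>carrier A. \<forall>c. app A a b = Some c \<longrightarrow> c \<in> carrier A) \<and>
     (\<exists>k\<in>carrier A. \<exists>s\<in>carrier A. \<forall>a\<in>carrier A. \<forall>b\<in>carrier A. \<forall>c\<in>carrier A.
        Some k \<bullet>\<^bsub>A\<^esub> Some a \<bullet>\<^bsub>A\<^esub> Some b = Some a \<and>
        Some s \<bullet>\<^bsub>A\<^esub> Some a \<bullet>\<^bsub>A\<^esub> Some b \<noteq> None \<and>
        (\<forall>d. (Some a \<bullet>\<^bsub>A\<^esub> Some c) \<bullet>\<^bsub>A\<^esub> (Some b \<bullet>\<^bsub>A\<^esub> Some c) = Some d \<longrightarrow>
             Some s \<bullet>\<^bsub>A\<^esub> Some a \<bullet>\<^bsub>A\<^esub> Some b \<bullet>\<^bsub>A\<^esub> Some c = Some d))"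

text \<open>A morphism \<open>\<gamma>\<close> is a relation, with \<open>\<gamma>(a)\<close> rendered as the image \<open>\<gamma> `` {a}\<close>.
  The composite \<open>\<delta> \<circ> \<gamma>\<close> is therefore \<open>\<gamma> O \<delta>\<close>, and the identity is \<open>Id_on (carrier A)\<close>.\<close>

definition applicative_morphism ::
    "('a, 'm) part_app_scheme \<Rightarrow> ('b, 'n) part_app_scheme \<Rightarrow> ('a \<times> 'b) set \<Rightarrow> bool" where
  "applicative_morphism A B \<gamma> \<longleftrightarrow>
     \<gamma> \<subseteq> carrier A \<times> carrier B \<and>
     (\<forall>a\<in>carrier A. \<gamma> `` {a} \<noteq> {}) \<and>
     (\<exists>r\<in>carrier B. \<forall>a\<in>carrier A. \<forall>a'\<in>carrier A. \<forall>c. app A a a' = Some c \<longrightarrow>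
        (\<forall>b\<in>\<gamma> `` {a}. \<forall>b'\<in>\<gamma> `` {a'}.
           \<exists>d\<in>\<gamma> `` {c}. Some r \<bullet>\<^bsub>B\<^esub> Some b \<bullet>\<^bsub>B\<^esub> Some b' = Some d))"

definition morphism_le ::
    "('a, 'm) part_app_scheme \<Rightarrow> ('b, 'n) part_app_scheme \<Rightarrow> ('a \<times> 'b) set \<Rightarrow> ('a \<times> 'b) set \<Rightarrow> bool"
  where
  "morphism_le A B \<gamma> \<delta> \<longleftrightarrow>
     (\<exists>s\<in>carrier B. \<forall>a\<in>carrier A. \<forall>b\<in>\<gamma> `` {a}. \<exists>c\<in>\<delta> `` {a}. app B s b = Some c)"

definition morphism_equiv ::
    "('a, 'm) part_app_scheme \<Rightarrow> ('b, 'n) part_app_scheme \<Rightarrow> ('a \<times> 'b) set \<Rightarrow> ('a \<times> 'b) set \<Rightarrow> bool"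
  where
  "morphism_equiv A B \<gamma> \<delta> \<longleftrightarrow> morphism_le A B \<gamma> \<delta> \<and> morphism_le A B \<delta> \<gamma>"

definition graph_on :: "'a set \<Rightarrow> ('a \<Rightarrow> 'b) \<Rightarrow> ('a \<times> 'b) set" where
  "graph_on S f = {(x, f x) | x. x \<in> S}"

text \<open>The code of the sequence \<open>n, \<beta>(0), \<dots>, \<beta>(k - 1)\<close>.\<close>

definition query :: "nat \<Rightarrow> (nat \<Rightarrow> nat) \<Rightarrow> nat \<Rightarrow> nat" where
  "query n \<beta> k = list_encode (n # map \<beta> [0..<k])"

definition K2_app :: "(nat \<Rightarrow> nat) \<Rightarrow> (nat \<Rightarrow> nat) \<Rightarrow> (nat \<Rightarrow> nat) option" where
  "K2_app \<alpha> \<beta> =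
     (if \<forall>n. \<exists>k. \<alpha> (query n \<beta> k) > 0
      then Some (\<lambda>n. \<alpha> (query n \<beta> (LEAST k. \<alpha> (query n \<beta> k) > 0)) - 1)
      else None)"

definition K2 :: "(nat \<Rightarrow> nat) part_app" where
  "K2 = \<lparr>carrier = UNIV, app = K2_app\<rparr>"

text \<open>The answer bit is read at the position one further than the least \<open>k\<close> carrying the
  flag \<open>1\<close>, i.e. at the code of \<open>n, \<beta>(0), \<dots>, \<beta>(k)\<close>.\<close>

definition two_omega_app :: "(nat \<Rightarrow> nat) \<Rightarrow> (nat \<Rightarrow> nat) \<Rightarrow> (nat \<Rightarrow> nat) option" where
  "two_omega_app \<alpha> \<beta> =
     (if \<forall>n. \<exists>k. \<alpha> (query n \<beta> k) = 1
      then Some (\<lambda>n. \<alpha> (query n \<beta> (Suc (LEAST k. \<alpha> (query n \<beta> k) = 1))))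
      else None)"

definition two_omega :: "(nat \<Rightarrow> nat) part_app" where
  "two_omega = \<lparr>carrier = {\<alpha>. range \<alpha> \<subseteq> {0, 1}}, app = two_omega_app\<rparr>"

definition eps_fun :: "(nat \<Rightarrow> nat) \<Rightarrow> nat \<Rightarrow> nat" where
  "eps_fun \<alpha> p = (case prod_decode p of (n, m) \<Rightarrow> if \<alpha> n = m then 1 else 0)"

definition eps :: "((nat \<Rightarrow> nat) \<times> (nat \<Rightarrow> nat)) set" where
  "eps = graph_on (carrier K2) eps_fun"

definition zeta :: "((nat \<Rightarrow> nat) \<times> (nat \<Rightarrow> nat)) set" where
  "zeta = graph_on (carrier two_omega) (\<lambda>\<alpha>. \<alpha>)"

end

theory Submission
  imports Defs
begin

text \<open>Both models are function-complete for continuity: application is continuous on its domain,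
  and every partial function on Baire space that is continuous on some set \<open>D\<close> is represented on
  \<open>D\<close> by an element, uniformly in parameters. Since neither model imposes computability, such an
  element can be written down directly: on the code of \<open>n, \<beta>(0), \<dots>, \<beta>(k - 1)\<close> it answers as soon
  as the prefix alone determines the \<open>n\<close>-th value for all arguments in \<open>D\<close>. These two properties
  give \<open>k\<close> and \<open>s\<close>, and they reduce the claims on \<open>\<epsilon>\<close> and \<open>\<zeta>\<close> to the fact that \<open>\<epsilon>\<close> is continuous
  with continuous inverse on its image.\<close>

section \<open>Continuity on subsets of Baire space\<close>

definition agree :: "nat \<Rightarrow> (nat \<Rightarrow> nat) \<Rightarrow> (nat \<Rightarrow> nat) \<Rightarrow> bool" where
  "agree k p q \<longleftrightarrow> (\<forall>i<k. p i = q i)"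

text \<open>Continuity for the subspace topology on \<open>D\<close>, coordinate by coordinate.
  Being relative to \<open>D\<close>, it lets a partial function be handled as a total one with
  arbitrary values outside its domain.\<close>

definition baire_cont :: "(nat \<Rightarrow> nat) set \<Rightarrow> ((nat \<Rightarrow> nat) \<Rightarrow> nat \<Rightarrow> nat) \<Rightarrow> bool" where
  "baire_cont D F \<longleftrightarrow> (\<forall>p\<in>D. \<forall>n. \<exists>k. \<forall>q\<in>D. agree k p q \<longrightarrow> F q n = F p n)"

text \<open>Pairing entry by entry rather than alternating: a prefix of length \<open>k\<close> of
  the pair amounts to prefixes of length \<open>k\<close> of both components, so moduli need no
  rescaling and one notion of continuity serves for several arguments.\<close>

definition interleave :: "(nat \<Rightarrow> nat) \<Rightarrow> (nat \<Rightarrow> nat) \<Rightarrow> nat \<Rightarrow> nat" where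
  "interleave a b = (\<lambda>i. prod_encode (a i, b i))"

definition left :: "(nat \<Rightarrow> nat) \<Rightarrow> nat \<Rightarrow> nat" where
  "left p = (\<lambda>i. fst (prod_decode (p i)))"

definition right :: "(nat \<Rightarrow> nat) \<Rightarrow> nat \<Rightarrow> nat" where
  "right p = (\<lambda>i. snd (prod_decode (p i)))"

lemma left_interleave [simp]: "left (interleave a b) = a"
  by (simp add: left_def interleave_def)

lemma right_interleave [simp]: "right (interleave a b) = b"
  by (simp add: right_def interleave_def)

lemma interleave_left_right [simp]: "interleave (left p) (right p) = p"
  by (simp add: left_def right_def interleave_def)

lemma agree_mono: "agree k p q \<Longrightarrow> j \<le> k \<Longrightarrow> agree j p q"
  by (auto simp: agree_def)

lemma agree_left: "agree k p q \<Longrightarrow> agree k (left p) (left q)"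
  by (auto simp: agree_def left_def)

lemma agree_right: "agree k p q \<Longrightarrow> agree k (right p) (right q)"
  by (auto simp: agree_def right_def)

lemma agree_map: "agree k p q \<Longrightarrow> j \<le> k \<Longrightarrow> map p [0..<j] = map q [0..<j]"
  by (auto simp: agree_def)

lemma agree_iff_map: "agree k p q \<longleftrightarrow> map p [0..<k] = map q [0..<k]"
  by (auto simp: agree_def)

lemma agree_interleave:
  "agree k (left p) (left q) \<Longrightarrow> agree k (right p) (right q) \<Longrightarrow> agree k p q"
  by (subst (1 2) interleave_left_right[symmetric]) (simp add: agree_def interleave_def)

lemma baire_contI:
  "(\<And>p n. p \<in> D \<Longrightarrow> \<exists>k. \<forall>q\<in>D. agree k p q \<longrightarrow> F q n = F p n) \<Longrightarrow> baire_cont D F"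
  by (simp add: baire_cont_def)

lemma baire_contD:
  "baire_cont D F \<Longrightarrow> p \<in> D \<Longrightarrow> \<exists>k. \<forall>q\<in>D. agree k p q \<longrightarrow> F q n = F p n"
  by (simp add: baire_cont_def)

text \<open>A prefix of the value involves finitely many coordinates, so the maximum of their moduli
  works. Composition needs this form.\<close>

lemma baire_cont_modulus:
  assumes "baire_cont D F" "p \<in> D"
  shows "\<exists>k. \<forall>q\<in>D. agree k p q \<longrightarrow> agree m (F p) (F q)"
proof (induction m)
  case 0
  show ?case by (simp add: agree_def)
next
  case (Suc m)
  then obtain k where k: "\<forall>q\<in>D. agree k p q \<longrightarrow> agree m (F p) (F q)" by blast
  obtain l where l: "\<forall>q\<in>D. agree l p q \<longrightarrow> F q m = F p m"
    using baire_contD[OF assms, of m] ..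
  have "agree (Suc m) (F p) (F q)" if "q \<in> D" "agree (max k l) p q" for q
  proof -
    have "agree k p q" "agree l p q"
      using that(2) by (simp_all add: agree_def)
    then have "agree m (F p) (F q)" "F q m = F p m"
      using k l that(1) by blast+
    then show ?thesis by (auto simp: agree_def less_Suc_eq)
  qed
  then show ?case by blast
qed

section \<open>Closure of continuity under composition and pairing\<close>

lemma baire_cont_compose:
  assumes F: "baire_cont D F" and G: "baire_cont E G" and FE: "\<And>p. p \<in> D \<Longrightarrow> F p \<in> E"
  shows "baire_cont D (\<lambda>p. G (F p))"
proof (rule baire_contI)
  fix p n assume p: "p \<in> D"
  obtain m where m: "\<forall>q\<in>E. agree m (F p) q \<longrightarrow> G q n = G (F p) n"
    using baire_contD[OF G FE[OF p], of n] ..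
  obtain k where "\<forall>q\<in>D. agree k p q \<longrightarrow> agree m (F p) (F q)"
    using baire_cont_modulus[OF F p, of m] ..
  then show "\<exists>k. \<forall>q\<in>D. agree k p q \<longrightarrow> G (F q) n = G (F p) n"
    using m FE by blast
qed

lemma baire_cont_id: "baire_cont D (\<lambda>p. p)"
proof (rule baire_contI)
  fix p :: "nat \<Rightarrow> nat" and n :: nat
  have "\<forall>q\<in>D. agree (Suc n) p q \<longrightarrow> q n = p n" by (simp add: agree_def)
  then show "\<exists>k. \<forall>q\<in>D. agree k p q \<longrightarrow> q n = p n" ..
qed

lemma baire_cont_pointwise:
  assumes F: "baire_cont D F" and GF: "\<And>p q n. F q n = F p n \<Longrightarrow> G q n = G p n"
  shows "baire_cont D G"
proof (rule baire_contI)
  fix p n assume "p \<in> D"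
  from baire_contD[OF F this, of n]
  obtain k where "\<forall>q\<in>D. agree k p q \<longrightarrow> F q n = F p n" ..
  then have "\<forall>q\<in>D. agree k p q \<longrightarrow> G q n = G p n" by (auto intro: GF)
  then show "\<exists>k. \<forall>q\<in>D. agree k p q \<longrightarrow> G q n = G p n" ..
qed

lemma baire_cont_left: "baire_cont D F \<Longrightarrow> baire_cont D (\<lambda>p. left (F p))"
  by (erule baire_cont_pointwise) (simp add: left_def)

lemma baire_cont_right: "baire_cont D F \<Longrightarrow> baire_cont D (\<lambda>p. right (F p))"
  by (erule baire_cont_pointwise) (simp add: right_def)

lemma baire_cont_interleave:
  assumes "baire_cont D F" "baire_cont D G"
  shows "baire_cont D (\<lambda>p. interleave (F p) (G p))"
proof (rule baire_contI)
  fix p n assume p: "p \<in> D"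
  obtain k where "\<forall>q\<in>D. agree k p q \<longrightarrow> F q n = F p n"
    using baire_contD[OF assms(1) p, of n] ..
  moreover obtain l where "\<forall>q\<in>D. agree l p q \<longrightarrow> G q n = G p n"
    using baire_contD[OF assms(2) p, of n] ..
  ultimately
  have "\<forall>q\<in>D. agree (max k l) p q \<longrightarrow> interleave (F q) (G q) n = interleave (F p) (G p) n"
    by (simp add: interleave_def agree_def)
  then show "\<exists>k. \<forall>q\<in>D. agree k p q \<longrightarrow> interleave (F q) (G q) n = interleave (F p) (G p) n"
    by blast
qed

text \<open>\<open>V p n xs\<close> stands for what the first \<open>length xs\<close> entries of
  the parameter \<open>p\<close> and the prefix \<open>xs\<close> of the argument reveal about the
  \<open>n\<close>-th value, with \<open>None\<close> for undecided. Every deciding prefix is sound,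
  so it suffices to wait for the first one.\<close>

definition approximation ::
    "(nat \<Rightarrow> nat) set \<Rightarrow> ((nat \<Rightarrow> nat) \<Rightarrow> nat \<Rightarrow> nat) \<Rightarrow>
      ((nat \<Rightarrow> nat) \<Rightarrow> nat \<Rightarrow> nat list \<Rightarrow> nat option) \<Rightarrow> bool" where
  "approximation D F V \<longleftrightarrow>
     (\<forall>p q n xs. agree (length xs) p q \<longrightarrow> V p n xs = V q n xs) \<and>
     (\<forall>p b n. interleave p b \<in> D \<longrightarrow>
        (\<exists>k. V p n (map b [0..<k]) \<noteq> None) \<and>
        (\<forall>k v. V p n (map b [0..<k]) = Some v \<longrightarrow> v = F (interleave p b) n))"

text \<open>A value counts as decided once all points of \<open>D\<close> compatible with the finite
  data share it; continuity makes this happen at some prefix. The value is obtained by choice, with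
  no concern for computability.\<close>

lemma approximation_exists:
  assumes F: "baire_cont D F"
  shows "\<exists>V. approximation D F V"
proof -
  \<comment> \<open>The points of \<open>D\<close> not yet excluded by the finite data.\<close>
  define C where "C p xs = {q \<in> D. map (left q) [0..<length xs] = map p [0..<length xs] \<and>
      map (right q) [0..<length xs] = xs}" for p :: "nat \<Rightarrow> nat" and xs
  \<comment> \<open>If \<open>C p xs\<close> is empty, an arbitrary value is chosen. Soundness is
    unaffected: it concerns only \<open>interleave p b\<close> in \<open>D\<close>, and that point
    then lies in \<open>C\<close>.\<close>
  define V where "V p n xs = (if \<exists>v. \<forall>q\<in>C p xs. F q n = v
      then Some (SOME v. \<forall>q\<in>C p xs. F q n = v) else None)" for p n xs
  have "approximation D F V"
    unfolding approximation_def
  proof (intro allI impI conjI)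
    show "V p n xs = V q n xs" if "agree (length xs) p q" for p q n xs
    proof -
      have "map p [0..<length xs] = map q [0..<length xs]"
        using that by (simp only: agree_iff_map)
      then have "C p xs = C q xs" unfolding C_def by (rule arg_cong)
      then show ?thesis by (simp add: V_def)
    qed
    show "\<exists>k. V p n (map b [0..<k]) \<noteq> None" if D: "interleave p b \<in> D" for p b n
    proof -
      obtain k where k: "\<forall>q\<in>D. agree k (interleave p b) q \<longrightarrow> F q n = F (interleave p b) n"
        using baire_contD[OF F D, of n] ..
      have "F q n = F (interleave p b) n" if "q \<in> C p (map b [0..<k])" for q
      proof -
        have "agree k (interleave p b) q"
          using that
          by - (rule agree_interleave, simp_all add: C_def agree_iff_map del: map_eq_conv)
        moreover have "q \<in> D" using that by (simp add: C_def)
        ultimately show ?thesis using k by blast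
      qed
      then have "\<exists>v. \<forall>q\<in>C p (map b [0..<k]). F q n = v" by blast
      then have "V p n (map b [0..<k]) \<noteq> None" by (simp only: V_def if_True) simp
      then show ?thesis ..
    qed
    show "v = F (interleave p b) n"
      if "interleave p b \<in> D" "V p n (map b [0..<k]) = Some v" for p b n k v
    proof -
      have ex: "\<exists>v. \<forall>q\<in>C p (map b [0..<k]). F q n = v"
      proof (rule ccontr)
        assume "\<not> ?thesis"
        then have "V p n (map b [0..<k]) = None" unfolding V_def by (rule if_not_P)
        with that(2) show False by simp
      qed
      then have "V p n (map b [0..<k]) = Some (SOME v. \<forall>q\<in>C p (map b [0..<k]). F q n = v)"
        unfolding V_def by (rule if_P)
      with that(2) have v: "(SOME v. \<forall>q\<in>C p (map b [0..<k]). F q n = v) = v" by simp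
      from someI_ex[OF ex] have "\<forall>q\<in>C p (map b [0..<k]). F q n = v" unfolding v .
      moreover have "interleave p b \<in> C p (map b [0..<k])"
        using that(1) by (simp add: C_def)
      ultimately show ?thesis by simp
    qed
  qed
  then show ?thesis by blast
qed

section \<open>Models closed under continuous functions\<close>

lemma image_graph_on: "x \<in> S \<Longrightarrow> graph_on S f `` {x} = {f x}"
  by (auto simp: graph_on_def)

text \<open>\<open>abstraction\<close> is a continuous s-m-n property: \<open>G p\<close> is a code
  for the section of \<open>F\<close> at \<open>p\<close>. Since \<open>G\<close> is total and
  continuous on all sequences, it can itself be represented, which allows currying and keeps
  \<open>s a b\<close> defined even where \<open>F\<close> has no value.\<close>

locale continuous_model =
  fixes A :: "(nat \<Rightarrow> nat) part_app"
  assumes app_closed: "\<lbrakk>a \<in> carrier A; b \<in> carrier A; app A a b = Some c\<rbrakk> \<Longrightarrow> c \<in> carrier A"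
    and app_cont: "baire_cont {p. app A (left p) (right p) \<noteq> None}
          (\<lambda>p. the (app A (left p) (right p)))"
    and abstraction: "\<lbrakk>baire_cont D F; \<And>q. q \<in> D \<Longrightarrow> F q \<in> carrier A\<rbrakk> \<Longrightarrow>
          \<exists>G. baire_cont UNIV G \<and> (\<forall>p. G p \<in> carrier A) \<and>
            (\<forall>p b. interleave p b \<in> D \<longrightarrow> app A (G p) b = Some (F (interleave p b)))"
begin

section \<open>Representing elements for functions of one, two and three arguments\<close>

lemma the_app_closed:
  "\<lbrakk>a \<in> carrier A; b \<in> carrier A; app A a b \<noteq> None\<rbrakk> \<Longrightarrow> the (app A a b) \<in> carrier A"
  by (rule app_closed[of a b]) auto

lemma represent1:
  assumes F: "baire_cont D F" "\<And>q. q \<in> D \<Longrightarrow> F q \<in> carrier A"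
  shows "\<exists>r\<in>carrier A. \<forall>b\<in>D. app A r b = Some (F b)"
proof -
  have cont: "baire_cont {q. right q \<in> D} (\<lambda>q. F (right q))"
    by (rule baire_cont_compose[OF baire_cont_right[OF baire_cont_id] F(1)]) simp
  have cl: "F (right q) \<in> carrier A" if "q \<in> {q. right q \<in> D}" for q
    using that F(2) by simp
  obtain G where "baire_cont UNIV G \<and> (\<forall>p. G p \<in> carrier A) \<and>
    (\<forall>p b. interleave p b \<in> {q. right q \<in> D} \<longrightarrow>
       app A (G p) b = Some (F (right (interleave p b))))"
    using abstraction[OF cont cl] ..
  \<comment> \<open>The function ignores its parameter, so any sequence may be supplied; the zero
    sequence is taken.\<close>
  then show ?thesis by (intro bexI[of _ "G (\<lambda>_. 0)"]) simp_all
qed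

text \<open>Currying: the total continuous \<open>G\<close> supplied by \<open>abstraction\<close>
  is in turn represented by an element \<open>r\<close>.\<close>

lemma represent2:
  assumes "baire_cont D F" "\<And>q. q \<in> D \<Longrightarrow> F q \<in> carrier A"
  shows "\<exists>r\<in>carrier A. \<exists>G. (\<forall>a. G a \<in> carrier A \<and> app A r a = Some (G a)) \<and>
    (\<forall>a b. interleave a b \<in> D \<longrightarrow> app A (G a) b = Some (F (interleave a b)))"
proof -
  obtain G where G: "baire_cont UNIV G \<and> (\<forall>p. G p \<in> carrier A) \<and>
    (\<forall>p b. interleave p b \<in> D \<longrightarrow> app A (G p) b = Some (F (interleave p b)))"
    using abstraction[OF assms] ..
  then obtain r where "r \<in> carrier A" "\<forall>b\<in>UNIV. app A r b = Some (G b)"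
    using represent1[of UNIV G] by auto
  with G show ?thesis by (intro bexI[of _ r] exI[of _ G]) simp_all
qed

text \<open>Abstracting the last argument leaves a total continuous function \<open>H\<close> of the
  first two, to which \<open>represent2\<close> applies.\<close>

lemma represent3:
  assumes "baire_cont D F" "\<And>q. q \<in> D \<Longrightarrow> F q \<in> carrier A"
  shows "\<exists>r\<in>carrier A. \<exists>G H. (\<forall>a. app A r a = Some (G a)) \<and>
    (\<forall>a b. app A (G a) b = Some (H a b)) \<and>
    (\<forall>a b c. interleave (interleave a b) c \<in> D \<longrightarrow>
       app A (H a b) c = Some (F (interleave (interleave a b) c)))"
proof -
  obtain H where H: "baire_cont UNIV H \<and> (\<forall>p. H p \<in> carrier A) \<and>
    (\<forall>p b. interleave p b \<in> D \<longrightarrow> app A (H p) b = Some (F (interleave p b)))"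
    using abstraction[OF assms] ..
  then have "baire_cont UNIV H" "\<And>p. p \<in> UNIV \<Longrightarrow> H p \<in> carrier A" by simp_all
  from represent2[OF this] obtain r where r: "r \<in> carrier A"
    "\<exists>G. (\<forall>a. G a \<in> carrier A \<and> app A r a = Some (G a)) \<and>
      (\<forall>a b. interleave a b \<in> UNIV \<longrightarrow> app A (G a) b = Some (H (interleave a b)))" ..
  from r(2) obtain G where "(\<forall>a. G a \<in> carrier A \<and> app A r a = Some (G a)) \<and>
      (\<forall>a b. interleave a b \<in> UNIV \<longrightarrow> app A (G a) b = Some (H (interleave a b)))" ..
  with r(1) H show ?thesis
    by (intro bexI[of _ r] exI[of _ G] exI[of _ "\<lambda>a b. H (interleave a b)"]) simp_all
qed

lemma baire_cont_app:
  assumes "baire_cont D F" "baire_cont D G"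
    and def: "\<And>p. p \<in> D \<Longrightarrow> app A (F p) (G p) \<noteq> None"
  shows "baire_cont D (\<lambda>p. the (app A (F p) (G p)))"
  using baire_cont_compose[OF baire_cont_interleave[OF assms(1,2)] app_cont] def by simp

text \<open>\<open>k\<close> represents the first projection, and \<open>s\<close> represents the
  map from \<open>a\<close>, \<open>b\<close>, \<open>c\<close> to \<open>(a c) (b c)\<close>,
  continuous where it is defined.\<close>

lemma pca: "pca A"
proof -
  \<comment> \<open>The domain is cut down because represented functions must take values in the
    carrier.\<close>
  have "baire_cont {p. left p \<in> carrier A} left"
    using baire_cont_left[OF baire_cont_id] by simp
  then have "\<exists>k\<in>carrier A. \<exists>K. (\<forall>a. K a \<in> carrier A \<and> app A k a = Some (K a)) \<and>
    (\<forall>a b. interleave a b \<in> {p. left p \<in> carrier A} \<longrightarrow>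
       app A (K a) b = Some (left (interleave a b)))"
    by (rule represent2) simp
  then obtain k K where k: "k \<in> carrier A" "\<And>a. app A k a = Some (K a)"
    "\<And>a b. a \<in> carrier A \<Longrightarrow> app A (K a) b = Some a"
    by (elim bexE exE conjE) simp
  \<comment> \<open>The triples, coded as \<open>interleave (interleave a b) c\<close>, for which
    \<open>(a c) (b c)\<close> is defined. Each inner application is required separately, because
    \<open>the\<close> would hide an undefined one.\<close>
  define D where "D = {p. left (left p) \<in> carrier A \<and> right (left p) \<in> carrier A \<and>
    right p \<in> carrier A \<and> app A (left (left p)) (right p) \<noteq> None \<and>
    app A (right (left p)) (right p) \<noteq> None \<and>
    app A (the (app A (left (left p)) (right p))) (the (app A (right (left p)) (right p))) \<noteq> None}"
  define F where "F p =
    the (app A (the (app A (left (left p)) (right p))) (the (app A (right (left p)) (right p))))"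
    for p
  note left = baire_cont_left[OF baire_cont_id] and right = baire_cont_right[OF baire_cont_id]
  have ac: "baire_cont D (\<lambda>p. the (app A (left (left p)) (right p)))"
    by (rule baire_cont_app[OF baire_cont_left[OF left] right]) (simp add: D_def)
  have bc: "baire_cont D (\<lambda>p. the (app A (right (left p)) (right p)))"
    by (rule baire_cont_app[OF baire_cont_right[OF left] right]) (simp add: D_def)
  have "baire_cont D F"
    unfolding F_def by (rule baire_cont_app[OF ac bc]) (simp add: D_def)
  moreover have "F p \<in> carrier A" if "p \<in> D" for p
    using that unfolding D_def F_def by (simp add: the_app_closed del: not_None_eq)
  ultimately have "\<exists>s\<in>carrier A. \<exists>G H. (\<forall>a. app A s a = Some (G a)) \<and>
    (\<forall>a b. app A (G a) b = Some (H a b)) \<and>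
    (\<forall>a b c. interleave (interleave a b) c \<in> D \<longrightarrow>
       app A (H a b) c = Some (F (interleave (interleave a b) c)))"
    by (rule represent3)
  then obtain s G H where s: "s \<in> carrier A" and
    GH: "\<And>a. app A s a = Some (G a)" "\<And>a b. app A (G a) b = Some (H a b)"
    "\<And>a b c. interleave (interleave a b) c \<in> D \<Longrightarrow>
       app A (H a b) c = Some (F (interleave (interleave a b) c))"
    by (elim bexE exE conjE) simp
  \<comment> \<open>Strict application unfolds to nested binds; if they succeed, the triple lies in
    \<open>D\<close>.\<close>
  have "app A (H a b) c = Some d"
    if "a \<in> carrier A" "b \<in> carrier A" "c \<in> carrier A"
      "Option.bind (app A a c) (\<lambda>x. Option.bind (app A b c) (app A x)) = Some d" for a b c d
    using that GH(3)[of a b c] by (auto simp: D_def F_def bind_eq_Some_conv)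
  then have "\<exists>k\<in>carrier A. \<exists>s\<in>carrier A. \<forall>a\<in>carrier A. \<forall>b\<in>carrier A. \<forall>c\<in>carrier A.
        Some k \<bullet>\<^bsub>A\<^esub> Some a \<bullet>\<^bsub>A\<^esub> Some b = Some a \<and>
        Some s \<bullet>\<^bsub>A\<^esub> Some a \<bullet>\<^bsub>A\<^esub> Some b \<noteq> None \<and>
        (\<forall>d. (Some a \<bullet>\<^bsub>A\<^esub> Some c) \<bullet>\<^bsub>A\<^esub> (Some b \<bullet>\<^bsub>A\<^esub> Some c) = Some d \<longrightarrow>
             Some s \<bullet>\<^bsub>A\<^esub> Some a \<bullet>\<^bsub>A\<^esub> Some b \<bullet>\<^bsub>A\<^esub> Some c = Some d)"
    unfolding papp_def using k s GH(1,2)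
    by (intro bexI[of _ k] bexI[of _ s]) simp_all
  then show ?thesis
    unfolding pca_def using app_closed by blast
qed

text \<open>A realizer sees only \<open>f x\<close>, so the comparison amounts to a continuous
  passage \<open>h\<close> from \<open>f x\<close> to \<open>g x\<close>; the element representing
  \<open>h\<close> is the witness.\<close>

lemma morphism_le_graph:
  assumes h: "baire_cont (f ` S) h" and hf: "\<And>x. x \<in> S \<Longrightarrow> h (f x) = g x"
    and g: "\<And>x. x \<in> S \<Longrightarrow> g x \<in> carrier A"
  shows "morphism_le A' A (graph_on S f) (graph_on S g)"
proof -
  have "\<And>q. q \<in> f ` S \<Longrightarrow> h q \<in> carrier A" using hf g by auto
  from represent1[OF h this] obtain r
    where "r \<in> carrier A" "\<forall>b\<in>f ` S. app A r b = Some (h b)" ..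
  then show ?thesis
    unfolding morphism_le_def by (intro bexI[of _ r]) (auto simp: hf graph_on_def)
qed

end

text \<open>Decoding both arguments by \<open>g\<close>, applying in \<open>A\<close> and encoding
  the result by \<open>f\<close> is continuous, hence represented in \<open>B\<close> by a curried
  realizer.\<close>

lemma embedding_applicative_morphism:
  assumes "continuous_model A" "continuous_model B"
    and f: "baire_cont (carrier A) f" "\<And>a. a \<in> carrier A \<Longrightarrow> f a \<in> carrier B"
    and g: "baire_cont (f ` carrier A) g" "\<And>a. a \<in> carrier A \<Longrightarrow> g (f a) = a"
  shows "applicative_morphism A B (graph_on (carrier A) f)"
proof -
  interpret A: continuous_model A by fact
  interpret B: continuous_model B by fact
  \<comment> \<open>Pairs of codes whose decoded elements can be applied to each other.\<close>
  define D where "D = {p. left p \<in> f ` carrier A \<and> right p \<in> f ` carrier A \<and>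
    app A (g (left p)) (g (right p)) \<noteq> None}"
  define F where "F p = f (the (app A (g (left p)) (g (right p))))" for p
  have gl: "baire_cont D (\<lambda>p. g (left p))"
    by (rule baire_cont_compose[OF baire_cont_left[OF baire_cont_id] g(1)]) (simp add: D_def)
  have gr: "baire_cont D (\<lambda>p. g (right p))"
    by (rule baire_cont_compose[OF baire_cont_right[OF baire_cont_id] g(1)]) (simp add: D_def)
  have cl: "the (app A (g (left p)) (g (right p))) \<in> carrier A" if "p \<in> D" for p
  proof (rule A.the_app_closed)
    show "g (left p) \<in> carrier A" "g (right p) \<in> carrier A"
      using that g(2) by (auto simp: D_def)
    show "app A (g (left p)) (g (right p)) \<noteq> None" using that by (simp add: D_def)
  qed
  have "baire_cont D F"
    unfolding F_def
    by (rule baire_cont_compose[OF A.baire_cont_app[OF gl gr] f(1)]) (auto simp: D_def cl)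
  moreover have "F p \<in> carrier B" if "p \<in> D" for p
    using cl[OF that] f(2) by (simp add: F_def)
  ultimately have "\<exists>r\<in>carrier B. \<exists>G. (\<forall>a. G a \<in> carrier B \<and> app B r a = Some (G a)) \<and>
    (\<forall>a b. interleave a b \<in> D \<longrightarrow> app B (G a) b = Some (F (interleave a b)))"
    by (rule B.represent2)
  then obtain r G where r: "r \<in> carrier B" "\<And>a. app B r a = Some (G a)"
    "\<And>a b. interleave a b \<in> D \<Longrightarrow> app B (G a) b = Some (F (interleave a b))"
    by (elim bexE exE conjE) simp
  have app: "app B (G (f a)) (f a') = Some (f c)"
    if "a \<in> carrier A" "a' \<in> carrier A" "app A a a' = Some c" for a a' c
    using that r(3)[of "f a" "f a'"] g(2) by (auto simp: D_def F_def)
  show ?thesis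
    unfolding applicative_morphism_def
  proof (intro conjI bexI[where P = "\<lambda>r. \<forall>a\<in>X. Q a r" and x = r for X Q] ballI allI impI)
    show "graph_on (carrier A) f \<subseteq> carrier A \<times> carrier B"
      using f(2) by (auto simp: graph_on_def)
    show "graph_on (carrier A) f `` {a} \<noteq> {}" if "a \<in> carrier A" for a
      using that by (simp add: image_graph_on)
    show "r \<in> carrier B" by fact
    fix a a' c b b'
    assume a: "a \<in> carrier A" "a' \<in> carrier A" "app A a a' = Some c"
      and "b \<in> graph_on (carrier A) f `` {a}" "b' \<in> graph_on (carrier A) f `` {a'}"
    then have "b = f a" "b' = f a'" by (simp_all add: image_graph_on)
    moreover have "c \<in> carrier A" using a by (rule A.app_closed)
    ultimately show "\<exists>d\<in>graph_on (carrier A) f `` {c}.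
        Some r \<bullet>\<^bsub>B\<^esub> Some b \<bullet>\<^bsub>B\<^esub> Some b' = Some d"
      using app[OF a] r(2) by (simp add: image_graph_on papp_def)
  qed
qed

section \<open>The two models\<close>

lemma query_cong: "agree k b b' \<Longrightarrow> j \<le> k \<Longrightarrow> query n b' j = query n b j"
  unfolding query_def by (metis agree_map)

text \<open>Continuity of application in finite form: the queries up to stage \<open>K\<close>
  consult finitely many entries of the operator and of the argument.\<close>

lemma queries_modulus:
  "\<exists>N. \<forall>q. agree N p q \<longrightarrow>
     (\<forall>j\<le>K. left q (query n (right q) j) = left p (query n (right p) j))"
proof -
  \<comment> \<open>The summand \<open>K\<close> makes the argument prefixes, and hence the query
    codes, coincide; the maximum puts these codes below \<open>N\<close>, where the operators
    agree.\<close>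
  define N where "N = K + Suc (Max ((\<lambda>j. query n (right p) j) ` {..K}))"
  have "left q (query n (right q) j) = left p (query n (right p) j)"
    if "agree N p q" "j \<le> K" for q j
  proof -
    have "query n (right q) j = query n (right p) j"
      using query_cong[OF agree_right[OF that(1)]] that(2) by (simp add: N_def)
    moreover have "query n (right p) j \<le> Max ((\<lambda>j. query n (right p) j) ` {..K})"
      using that(2) by (intro Max_ge) auto
    then have "query n (right p) j < N" by (simp add: N_def)
    ultimately show ?thesis
      using agree_left[OF that(1)] by (simp add: agree_def)
  qed
  then show ?thesis by blast
qed

text \<open>A search inspects its predicate only up to the point where it stops.\<close>

lemma Least_cong_upto:
  fixes P Q :: "nat \<Rightarrow> bool"
  assumes "\<exists>k. P k" "\<And>j. j \<le> (LEAST k. P k) \<Longrightarrow> Q j = P j"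
  shows "(LEAST k. Q k) = (LEAST k. P k)"
proof (rule Least_equality)
  show "Q (LEAST k. P k)" using assms LeastI_ex by auto
  show "(LEAST k. P k) \<le> y" if "Q y" for y
    using assms(2) that by (metis Least_le nle_le)
qed

lemma K2_continuous_model: "continuous_model K2"
proof
  show "c \<in> carrier K2" for c by (simp add: K2_def)
next
  show "baire_cont {p. app K2 (left p) (right p) \<noteq> None}
      (\<lambda>p. the (app K2 (left p) (right p)))"
  proof (rule baire_contI)
    fix p n assume "p \<in> {p. app K2 (left p) (right p) \<noteq> None}"
    then have p: "\<forall>n. \<exists>k. left p (query n (right p) k) > 0"
      by (auto simp: K2_def K2_app_def split: if_splits)
    \<comment> \<open>The stage at which the computation of the \<open>n\<close>-th value stops for
      \<open>p\<close>; it is the same for every admissible \<open>q\<close> close enough to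
      \<open>p\<close>.\<close>
    define K where "K = (LEAST k. left p (query n (right p) k) > 0)"
    obtain N where N: "\<And>q j. agree N p q \<Longrightarrow> j \<le> K \<Longrightarrow>
        left q (query n (right q) j) = left p (query n (right p) j)"
      using queries_modulus by metis
    have "the (app K2 (left q) (right q)) n = the (app K2 (left p) (right p)) n"
      if "app K2 (left q) (right q) \<noteq> None" "agree N p q" for q
    proof -
      have "\<forall>n. \<exists>k. left q (query n (right q) k) > 0"
        using that(1) by (auto simp: K2_def K2_app_def split: if_splits)
      moreover have "(LEAST k. left q (query n (right q) k) > 0) = K"
        unfolding K_def using p N[OF that(2)] by (intro Least_cong_upto) (auto simp: K_def)
      ultimately show ?thesis
        using p N[OF that(2), of K] by (simp add: K2_def K2_app_def K_def)
    qed
    then show "\<exists>k. \<forall>q\<in>{p. app K2 (left p) (right p) \<noteq> None}. agree k p q \<longrightarrow>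
        the (app K2 (left q) (right q)) n = the (app K2 (left p) (right p)) n" by blast
  qed
next
  fix D F assume F: "baire_cont D F"
  obtain V where "approximation D F V"
    using approximation_exists[OF F] by blast
  then have V: "\<And>p q n xs. agree (length xs) p q \<Longrightarrow> V p n xs = V q n xs"
    "\<And>p b n. interleave p b \<in> D \<Longrightarrow> \<exists>k. V p n (map b [0..<k]) \<noteq> None"
    "\<And>p b n k v. interleave p b \<in> D \<Longrightarrow> V p n (map b [0..<k]) = Some v \<Longrightarrow>
       v = F (interleave p b) n"
    unfolding approximation_def by blast+
  \<comment> \<open>\<open>0\<close> means no answer yet and \<open>Suc v\<close> the answer
    \<open>v\<close>, matching the subtraction of 1 in \<open>K2_app\<close>. The empty list is
    never a query and gets the default \<open>0\<close>.\<close>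
  define G where "G p c = (case list_decode c of [] \<Rightarrow> 0
    | n # xs \<Rightarrow> (case V p n xs of None \<Rightarrow> 0 | Some v \<Rightarrow> Suc v))" for p c
  have Gq: "G p (query n b k) = (case V p n (map b [0..<k]) of None \<Rightarrow> 0 | Some v \<Rightarrow> Suc v)"
    for p n b k by (simp add: G_def query_def)
  \<comment> \<open>The entry at \<open>c\<close> consults \<open>p\<close> only up to the length of
    the decoded list, whence continuity in the parameter.\<close>
  have "G q c = G p c" if "agree (length (list_decode c)) p q" for p q c
  proof (cases "list_decode c")
    case (Cons n xs)
    then have "V p n xs = V q n xs" using agree_mono[OF that] by (intro V(1)) simp
    then show ?thesis by (simp add: G_def Cons)
  qed (simp add: G_def)
  then have "baire_cont UNIV G" by (intro baire_contI) blast
  moreover have "app K2 (G p) b = Some (F (interleave p b))" if D: "interleave p b \<in> D" for p b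
  proof -
    have ex: "\<exists>k. G p (query n b k) > 0" for n
    proof -
      obtain k v where "V p n (map b [0..<k]) = Some v" using V(2)[OF D] by blast
      then have "G p (query n b k) > 0" by (simp add: Gq)
      then show ?thesis by blast
    qed
    have val: "G p (query n b k) - 1 = F (interleave p b) n" if "G p (query n b k) > 0" for n k
    proof (cases "V p n (map b [0..<k])")
      case None
      with that show ?thesis by (simp add: Gq)
    next
      case (Some v)
      with V(3)[OF D Some] show ?thesis by (simp add: Gq)
    qed
    have "G p (query n b (LEAST k. G p (query n b k) > 0)) - 1 = F (interleave p b) n" for n
      using val LeastI_ex[OF ex] by blast
    with ex show ?thesis by (simp add: K2_def K2_app_def)
  qed
  ultimately show "\<exists>G. baire_cont UNIV G \<and> (\<forall>p. G p \<in> carrier K2) \<and>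
      (\<forall>p b. interleave p b \<in> D \<longrightarrow> app K2 (G p) b = Some (F (interleave p b)))"
    by (auto simp: K2_def)
qed

lemma two_omega_continuous_model: "continuous_model two_omega"
proof
  show "c \<in> carrier two_omega" if "a \<in> carrier two_omega" "app two_omega a b = Some c" for a b c
  proof -
    have "a i \<in> {0, 1}" for i using that(1) by (auto simp: two_omega_def)
    then have "c n \<in> {0, 1}" for n
      using that(2) by (auto simp: two_omega_def two_omega_app_def split: if_splits)
    then have "range c \<subseteq> {0, 1}" by (intro image_subsetI)
    then show ?thesis by (simp add: two_omega_def)
  qed
next
  show "baire_cont {p. app two_omega (left p) (right p) \<noteq> None}
      (\<lambda>p. the (app two_omega (left p) (right p)))"
  proof (rule baire_contI)
    fix p n assume "p \<in> {p. app two_omega (left p) (right p) \<noteq> None}"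
    then have p: "\<forall>n. \<exists>k. left p (query n (right p) k) = 1"
      by (auto simp: two_omega_def two_omega_app_def split: if_splits)
    define K where "K = (LEAST k. left p (query n (right p) k) = 1)"
    \<comment> \<open>The bound is \<open>Suc K\<close>, as the answer bit is read one position past
      the flag.\<close>
    obtain N where N: "\<And>q j. agree N p q \<Longrightarrow> j \<le> Suc K \<Longrightarrow>
        left q (query n (right q) j) = left p (query n (right p) j)"
      using queries_modulus by metis
    have "the (app two_omega (left q) (right q)) n = the (app two_omega (left p) (right p)) n"
      if "app two_omega (left q) (right q) \<noteq> None" "agree N p q" for q
    proof -
      have "\<forall>n. \<exists>k. left q (query n (right q) k) = 1"
        using that(1) by (auto simp: two_omega_def two_omega_app_def split: if_splits)
      moreover have "(LEAST k. left q (query n (right q) k) = 1) = K"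
        unfolding K_def using p N[OF that(2)] by (intro Least_cong_upto) (auto simp: K_def)
      ultimately show ?thesis
        using p N[OF that(2), of "Suc K"] by (simp add: two_omega_def two_omega_app_def K_def)
    qed
    then show "\<exists>k. \<forall>q\<in>{p. app two_omega (left p) (right p) \<noteq> None}. agree k p q \<longrightarrow>
        the (app two_omega (left q) (right q)) n = the (app two_omega (left p) (right p)) n"
      by blast
  qed
next
  fix D F assume F: "baire_cont D F" and F2: "\<And>q. q \<in> D \<Longrightarrow> F q \<in> carrier two_omega"
  obtain V where "approximation D F V"
    using approximation_exists[OF F] by blast
  then have V: "\<And>p q n xs. agree (length xs) p q \<Longrightarrow> V p n xs = V q n xs"
    "\<And>p b n. interleave p b \<in> D \<Longrightarrow> \<exists>k. V p n (map b [0..<k]) \<noteq> None"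
    "\<And>p b n k v. interleave p b \<in> D \<Longrightarrow> V p n (map b [0..<k]) = Some v \<Longrightarrow>
       v = F (interleave p b) n"
    unfolding approximation_def by blast+
  text \<open>The flag goes up at the first prefix deciding the \<open>n\<close>-th value, so the answer has to be
    given at a sequence whose \<^emph>\<open>proper\<close> prefix decides it.\<close>
  define G where "G p c = (case list_decode c of [] \<Rightarrow> (0::nat)
    | n # xs \<Rightarrow> if xs \<noteq> [] \<and> V p n (butlast xs) \<noteq> None then of_bool (V p n (butlast xs) = Some 1)
        else of_bool (V p n xs \<noteq> None))" for p c
  have G0: "G p (query n b 0) = of_bool (V p n [] \<noteq> None)" for p n b
    by (simp add: G_def query_def)
  have GSuc: "G p (query n b (Suc k)) =
      (if V p n (map b [0..<k]) \<noteq> None then of_bool (V p n (map b [0..<k]) = Some 1)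
       else of_bool (V p n (map b [0..<Suc k]) \<noteq> None))" for p n b k
    by (simp add: G_def query_def)
  have "G q c = G p c" if "agree (length (list_decode c)) p q" for p q c
  proof (cases "list_decode c")
    case (Cons n xs)
    then have "V p n xs = V q n xs" "V p n (butlast xs) = V q n (butlast xs)"
      using agree_mono[OF that] by (auto intro!: V(1))
    then show ?thesis by (simp add: G_def Cons)
  qed (simp add: G_def)
  then have "baire_cont UNIV G" by (intro baire_contI) blast
  moreover have "G p \<in> carrier two_omega" for p
    by (auto simp: two_omega_def G_def split: list.splits)
  moreover have "app two_omega (G p) b = Some (F (interleave p b))"
    if D: "interleave p b \<in> D" for p b
  proof -
    \<comment> \<open>The first deciding stage, which turns out to be where the flag goes
      up.\<close>
    define K where "K n = (LEAST k. V p n (map b [0..<k]) \<noteq> None)" for n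
    have KV: "V p n (map b [0..<K n]) \<noteq> None" for n
      unfolding K_def by (rule LeastI_ex[OF V(2)[OF D]])
    have before: "V p n (map b [0..<k]) = None" if "k < K n" for n k
      using not_less_Least that unfolding K_def by blast
    have flag: "G p (query n b (K n)) = 1" for n
      using KV[of n] before[of "K n - 1" n] by (cases "K n") (auto simp: G0 GSuc)
    \<comment> \<open>Before stage \<open>K n\<close> neither the prefix nor its proper prefix
      decides, so \<open>G\<close> yields \<open>0\<close>.\<close>
    have "G p (query n b k) \<noteq> 1" if "k < K n" for n k
      using before[OF that] before[of "k - 1" n] that by (cases k) (auto simp: G0 GSuc)
    then have least: "(LEAST k. G p (query n b k) = 1) = K n" for n
      using flag by (intro Least_equality) (auto simp: not_less[symmetric])
    have "F (interleave p b) n \<in> {0, 1}" for n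
      using F2[OF D] by (auto simp: two_omega_def)
    \<comment> \<open>One step after the flag the proper prefix is the deciding one, so the answer
      clause of \<open>G\<close> applies. Its bit is the exact value because \<open>F\<close> takes
      values in \<open>{0, 1}\<close>.\<close>
    then have "G p (query n b (Suc (K n))) = F (interleave p b) n" for n
      using KV[of n] V(3)[OF D, of n "K n"] unfolding GSuc by fastforce
    then show ?thesis
      using flag by (auto simp: two_omega_def two_omega_app_def least simp del: One_nat_def)
  qed
  ultimately show "\<exists>G. baire_cont UNIV G \<and> (\<forall>p. G p \<in> carrier two_omega) \<and>
      (\<forall>p b. interleave p b \<in> D \<longrightarrow> app two_omega (G p) b = Some (F (interleave p b)))"
    by blast
qed

section \<open>The embedding of Baire space into Cantor space\<close>

text \<open>\<open>eps_fun a\<close> is the characteristic function of the graph of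
  \<open>a\<close>, which is decoded here; continuity is claimed only on the image of
  \<open>eps_fun\<close>.\<close>

definition eps_inv :: "(nat \<Rightarrow> nat) \<Rightarrow> nat \<Rightarrow> nat" where
  "eps_inv b n = (THE m. b (prod_encode (n, m)) = 1)"

lemma eps_inv_eps_fun [simp]: "eps_inv (eps_fun a) = a"
  by (auto simp: eps_inv_def eps_fun_def)

lemma eps_fun_in_two_omega [simp]: "eps_fun a \<in> carrier two_omega"
  by (auto simp: two_omega_def eps_fun_def split: prod.splits)

text \<open>The entry at the code of \<open>(n, m)\<close> depends on the \<open>n\<close>-th value
  alone.\<close>

lemma eps_fun_cont: "baire_cont D eps_fun"
proof (rule baire_contI)
  fix p :: "nat \<Rightarrow> nat" and c :: nat
  have "\<forall>q\<in>D. agree (Suc (fst (prod_decode c))) p q \<longrightarrow> eps_fun q c = eps_fun p c"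
    by (auto simp: agree_def eps_fun_def split: prod.splits)
  then show "\<exists>k. \<forall>q\<in>D. agree k p q \<longrightarrow> eps_fun q c = eps_fun p c" by blast
qed

text \<open>A prefix containing the \<open>1\<close> at the code of \<open>(n, a n)\<close> fixes
  the \<open>n\<close>-th value. Its length depends on \<open>a n\<close>, not on \<open>n\<close>
  alone.\<close>

lemma eps_inv_cont: "baire_cont (eps_fun ` S) eps_inv"
proof (rule baire_contI)
  fix b n assume "b \<in> eps_fun ` S"
  then obtain a where b: "b = eps_fun a" by blast
  have "a' n = a n" if "agree (Suc (prod_encode (n, a n))) (eps_fun a) (eps_fun a')" for a'
    using that by (auto simp: agree_def eps_fun_def dest!: spec[of _ "prod_encode (n, a n)"]
        split: if_splits)
  then show "\<exists>k. \<forall>q\<in>eps_fun ` S. agree k b q \<longrightarrow> eps_inv q n = eps_inv b n"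
    unfolding b by (intro exI[of _ "Suc (prod_encode (n, a n))"]) auto
qed

text \<open>As \<open>zeta\<close> is an inclusion, both composites act by \<open>eps_fun\<close>;
  only the carriers differ.\<close>

lemma eps_zeta: "eps O zeta = graph_on (carrier K2) eps_fun"
  using eps_fun_in_two_omega by (fastforce simp: eps_def zeta_def graph_on_def)

lemma zeta_eps: "zeta O eps = graph_on (carrier two_omega) eps_fun"
  by (fastforce simp: eps_def zeta_def graph_on_def K2_def)

lemma Id_on_graph: "Id_on S = graph_on S (\<lambda>x. x)"
  by (auto simp: graph_on_def)

theorem proposition2p15:
  shows "pca K2 \<and> pca two_omega \<and>
    applicative_morphism K2 two_omega eps \<and>
    applicative_morphism two_omega K2 zeta \<and>
    morphism_equiv K2 K2 (eps O zeta) (Id_on (carrier K2)) \<and>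
    morphism_equiv two_omega two_omega (zeta O eps) (Id_on (carrier two_omega))"
proof -
  interpret K: continuous_model K2 by (rule K2_continuous_model)
  interpret T: continuous_model two_omega by (rule two_omega_continuous_model)
  have KU: "a \<in> carrier K2" for a by (simp add: K2_def)
  have "applicative_morphism K2 two_omega eps"
    unfolding eps_def
    by (rule embedding_applicative_morphism[OF K2_continuous_model two_omega_continuous_model
          eps_fun_cont _ eps_inv_cont]) simp_all
  \<comment> \<open>The identity serves as embedding and as inverse.\<close>
  moreover have "applicative_morphism two_omega K2 zeta"
    unfolding zeta_def
    by (rule embedding_applicative_morphism[OF two_omega_continuous_model K2_continuous_model
          baire_cont_id _ baire_cont_id]) (simp_all add: KU)
  \<comment> \<open>\<open>eps_inv\<close> leads from the composite to the identity and
    \<open>eps_fun\<close> back; the same two maps serve for \<open>two_omega\<close>.\<close>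
  moreover have "morphism_equiv K2 K2 (eps O zeta) (Id_on (carrier K2))"
    unfolding morphism_equiv_def eps_zeta Id_on_graph
    by (intro conjI K.morphism_le_graph[OF eps_inv_cont] K.morphism_le_graph[OF eps_fun_cont])
      (simp_all add: KU)
  moreover have "morphism_equiv two_omega two_omega (zeta O eps) (Id_on (carrier two_omega))"
    unfolding morphism_equiv_def zeta_eps Id_on_graph
    by (intro conjI T.morphism_le_graph[OF eps_inv_cont] T.morphism_le_graph[OF eps_fun_cont])
      simp_all
  ultimately show ?thesis using K.pca T.pca by blast
qed

end
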